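(* Let $\mathbb{F}$ be a field of characteristic different from two and let $A$ be a finite-dimensional commutative $\mathbb{F}$-algebra with squaring map $H_A\colon A\to A$, $H_A(x)=x^2$. Then $$\operatorname{edim}(A)=\dim A+\varepsilon(A)=\operatorname{sr}(H_A)=\operatorname{wr}(H_A)+\dim\operatorname{Ann}(A).$$ In particular, if $A$ is unital, then $\operatorname{edim}(A)=\operatorname{wr}(H_A)$.
   Context: An algebra over a field $\mathbb{F}$ is an $\mathbb{F}$-vector space with a bilinear multiplication, not assumed associative or unital. Algebra morphisms are linear multiplicative maps (not required to preserve a unit). An algebra $E$ over $\mathbb{F}$ is an evolution algebra if it admits a basis $\{e_i : i\in I\}$, called a natural basis, such that $e_ie_j=0$ whenever $i\neq j$. The minimal evolution dimension is $\operatorname{edim}(A)=\min\{\dim E : E \text{ is an evolution } \mathbb{F}\text{-algebra admitting an algebra monomorphism } A\hookrightarrow E\}$. $\operatorname{Ann}(A)=\{x\in A : xA=0\}$. For a basis $B=\{b_1,\dots,b_n\}$ of $A$, $\varepsilon_B(A)$ is the minimal non-negative integer $s$ such that there exist $v_1,\dots,v_s\in A$ and linear functionals $\beta_1,\dots,\beta_s\in A^*$ with $b_ib_j=\sum_{k=1}^s\beta_k(b_i)\beta_k(b_j)v_k$ for all $i\neq j$. Set $\varepsilon(A)=\min\{\varepsilon_B(A) : B \text{ a basis of } A\}$. A (simultaneous) Waring decomposition of length $m$ of a homogeneous quadratic map $H\colon V\to V$ on a finite-dimensional vector space $V$ is an expression $H(x)=\sum_{k=1}^m\ell_k(x)^2v_k$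 with $\ell_k\in V^*$ and $v_k\in V$; its associated linear map is $L\colon V\to\mathbb{F}^m$, $L(x)=(\ell_1(x),\dots,\ell_m(x))$. The Waring rank $\operatorname{wr}(H)$ is the minimal length of a Waring decomposition of $H$, and $\operatorname{sr}(H)$ is the minimal length of a Waring decomposition of $H$ for which $L$ is injective. *)

theory Defs
  imports Main "HOL-Library.Extended_Nat" "HOL-Library.Function_Algebras"
begin

section \<open>Algebras and evolution algebras\<close>

text \<open>
  Vector spaces are those of the library locale \<^locale>\<open>vector_space\<close>, with scalar multiplication
  \<open>s\<close>. The carrier of an algebra is a subspace \<open>E\<close> of the ambient space, so that
  algebras of different dimensions can live in one type; products are constrained on \<open>E\<close> only.
\<close>

locale algebra_on = vector_space s
  for s :: "'f::field \<Rightarrow> 'v::ab_group_add \<Rightarrow> 'v" +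
  fixes E :: "'v set" and mul :: "'v \<Rightarrow> 'v \<Rightarrow> 'v"
  assumes subspace_carrier: "subspace E"
    and mul_closed: "\<lbrakk>x \<in> E; y \<in> E\<rbrakk> \<Longrightarrow> mul x y \<in> E"
    and mul_add_left: "\<lbrakk>x \<in> E; y \<in> E; z \<in> E\<rbrakk> \<Longrightarrow> mul (x + y) z = mul x z + mul y z"
    and mul_add_right: "\<lbrakk>x \<in> E; y \<in> E; z \<in> E\<rbrakk> \<Longrightarrow> mul x (y + z) = mul x y + mul x z"
    and mul_scale_left: "\<lbrakk>x \<in> E; y \<in> E\<rbrakk> \<Longrightarrow> mul (s c x) y = s c (mul x y)"
    and mul_scale_right: "\<lbrakk>x \<in> E; y \<in> E\<rbrakk> \<Longrightarrow> mul x (s c y) = s c (mul x y)"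

definition is_basis :: "('f::field \<Rightarrow> 'v::ab_group_add \<Rightarrow> 'v) \<Rightarrow> 'v set \<Rightarrow> 'v set \<Rightarrow> bool" where
  "is_basis s E B \<longleftrightarrow> \<not> module.dependent s B \<and> module.span s B = E"

definition evolution_algebra ::
  "('f::field \<Rightarrow> 'v::ab_group_add \<Rightarrow> 'v) \<Rightarrow> 'v set \<Rightarrow> ('v \<Rightarrow> 'v \<Rightarrow> 'v) \<Rightarrow> bool" where
  "evolution_algebra s E mul \<longleftrightarrow> algebra_on s E mul \<and>
     (\<exists>B. is_basis s E B \<and> (\<forall>x\<in>B. \<forall>y\<in>B. x \<noteq> y \<longrightarrow> mul x y = 0))"

text \<open>The source of a monomorphism is an algebra whose carrier is its whole type.\<close>

definition algebra_mono ::
  "('f::field \<Rightarrow> 'v::ab_group_add \<Rightarrow> 'v) \<Rightarrow> ('v \<Rightarrow> 'v \<Rightarrow> 'v) \<Rightarrow>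
   ('f \<Rightarrow> 'w::ab_group_add \<Rightarrow> 'w) \<Rightarrow> 'w set \<Rightarrow> ('w \<Rightarrow> 'w \<Rightarrow> 'w) \<Rightarrow> ('v \<Rightarrow> 'w) \<Rightarrow> bool" where
  "algebra_mono s mul s' E mul' f \<longleftrightarrow>
     Vector_Spaces.linear s s' f \<and> range f \<subseteq> E \<and> inj f \<and> (\<forall>x y. f (mul x y) = mul' (f x) (f y))"

text \<open>The library's \<open>dim\<close> is a natural number and says nothing about infinite-dimensional subspaces.\<close>

definition edimension :: "('f::field \<Rightarrow> 'v::ab_group_add \<Rightarrow> 'v) \<Rightarrow> 'v set \<Rightarrow> enat" where
  "edimension s E =
     (if \<exists>B. finite B \<and> E \<subseteq> module.span s B then enat (vector_space.dim s E) else \<infinity>)"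

definition fun_scale :: "'f::field \<Rightarrow> (nat \<Rightarrow> 'f) \<Rightarrow> (nat \<Rightarrow> 'f)" where
  "fun_scale c f = (\<lambda>i. c * f i)"

text \<open>
  HOL cannot quantify over types inside a definition, so \<open>E\<close> ranges over all evolution
  algebras, with arbitrary multiplication, carried by an arbitrary subspace of the space of sequences
  over the field; every finite-dimensional space is isomorphic to such a subspace. Lemma
  \<open>edim_le_any_type\<close> below shows that evolution algebras on other types do not lower the
  minimum. All minima below are infima in \<^typ>\<open>enat\<close>: they are attained if some value is
  finite, and the minimum over an empty set is \<open>\<infinity>\<close>.
\<close>

definition edim :: "('f::field \<Rightarrow> 'v::ab_group_add \<Rightarrow> 'v) \<Rightarrow> ('v \<Rightarrow> 'v \<Rightarrow> 'v) \<Rightarrow> enat" where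
  "edim s mul =
     Inf {edimension fun_scale E | E mul' f.
            evolution_algebra fun_scale E mul' \<and> algebra_mono s mul fun_scale E mul' f}"

definition Ann :: "('v::zero \<Rightarrow> 'v \<Rightarrow> 'v) \<Rightarrow> 'v set" where
  "Ann mul = {x. \<forall>y. mul x y = 0}"


section \<open>The invariant \<open>\<epsilon>\<close>\<close>

definition eps_basis ::
  "('f::field \<Rightarrow> 'v::ab_group_add \<Rightarrow> 'v) \<Rightarrow> ('v \<Rightarrow> 'v \<Rightarrow> 'v) \<Rightarrow> 'v set \<Rightarrow> enat" where
  "eps_basis s mul B =
     Inf {enat m | m. \<exists>(v :: nat \<Rightarrow> 'v) (\<beta> :: nat \<Rightarrow> 'v \<Rightarrow> 'f).
            (\<forall>k<m. Vector_Spaces.linear s (*) (\<beta> k)) \<and>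
            (\<forall>b\<in>B. \<forall>c\<in>B. b \<noteq> c \<longrightarrow> mul b c = (\<Sum>k<m. s (\<beta> k b * \<beta> k c) (v k)))}"

definition eps :: "('f::field \<Rightarrow> 'v::ab_group_add \<Rightarrow> 'v) \<Rightarrow> ('v \<Rightarrow> 'v \<Rightarrow> 'v) \<Rightarrow> enat" where
  "eps s mul = Inf {eps_basis s mul B | B. is_basis s UNIV B}"


section \<open>Waring decompositions\<close>

definition waring_decomposition ::
  "('f::field \<Rightarrow> 'v::ab_group_add \<Rightarrow> 'v) \<Rightarrow> ('v \<Rightarrow> 'v) \<Rightarrow> nat \<Rightarrow>
   (nat \<Rightarrow> 'v \<Rightarrow> 'f) \<Rightarrow> (nat \<Rightarrow> 'v) \<Rightarrow> bool" where
  "waring_decomposition s H m l v \<longleftrightarrow>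
     (\<forall>k<m. Vector_Spaces.linear s (*) (l k)) \<and> (\<forall>x. H x = (\<Sum>k<m. s ((l k x)\<^sup>2) (v k)))"

text \<open>Vectors with \<open>m\<close> entries are encoded as sequences vanishing from position \<open>m\<close> on.\<close>

definition associated_map :: "nat \<Rightarrow> (nat \<Rightarrow> 'v \<Rightarrow> 'f::zero) \<Rightarrow> 'v \<Rightarrow> (nat \<Rightarrow> 'f)" where
  "associated_map m l x = (\<lambda>k. if k < m then l k x else 0)"

definition wr :: "('f::field \<Rightarrow> 'v::ab_group_add \<Rightarrow> 'v) \<Rightarrow> ('v \<Rightarrow> 'v) \<Rightarrow> enat" where
  "wr s H = Inf {enat m | m. \<exists>l v. waring_decomposition s H m l v}"

definition sr :: "('f::field \<Rightarrow> 'v::ab_group_add \<Rightarrow> 'v) \<Rightarrow> ('v \<Rightarrow> 'v) \<Rightarrow> enat" where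
  "sr s H = Inf {enat m | m. \<exists>l v. waring_decomposition s H m l v \<and> inj (associated_map m l)}"


section \<open>Independence of \<open>edim\<close> from the type carrying the evolution algebra\<close>

lemma vector_space_fun_scale: "vector_space fun_scale"
  by unfold_locales (auto simp: fun_scale_def algebra_simps fun_eq_iff)

lemma edim_le_any_type:
  fixes s :: "'f::field \<Rightarrow> 'v::ab_group_add \<Rightarrow> 'v" and t :: "'f \<Rightarrow> 'w::ab_group_add \<Rightarrow> 'w"
  assumes ev: "evolution_algebra t E m" and mono: "algebra_mono s mul t E m f"
  shows "edim s mul \<le> edimension t E"
proof (cases "\<exists>B. finite B \<and> E \<subseteq> module.span t B")
  case False
  then show ?thesis by (auto simp: edimension_def)
next
  case True
  interpret E: algebra_on t E m using ev by (simp add: evolution_algebra_def)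
  interpret F: vector_space "fun_scale :: 'f \<Rightarrow> _" by (rule vector_space_fun_scale)
  interpret P: vector_space_pair t "fun_scale :: 'f \<Rightarrow> _" by unfold_locales
  obtain B where B: "E.independent B" "E.span B = E" "\<And>x y. x\<in>B \<Longrightarrow> y\<in>B \<Longrightarrow> x \<noteq> y \<Longrightarrow> m x y = 0"
    using ev by (auto simp: evolution_algebra_def is_basis_def)
  have BE: "B \<subseteq> E" using B(2) E.span_superset by blast
  have finB: "finite B"
    using True B(1) BE E.independent_span_bound by (meson order.trans)
  then obtain b where b: "B = b ` {i::nat. i < card B}"
    using finite_imp_nat_seg_image_inj_on[of B] by (metis card_Collect_less_nat card_image)
  define C where "C = E.extend_basis B"
  have C: "E.independent C" "E.span C = UNIV" "B \<subseteq> C"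
    using B(1) E.independent_extend_basis E.span_extend_basis E.extend_basis_superset
    by (auto simp: C_def)
  define g where "g x = (\<lambda>i. E.representation C x (b i))" for x
  have lin: "Vector_Spaces.linear t fun_scale g"
    by unfold_locales
      (auto simp: g_def fun_scale_def fun_eq_iff E.representation_add E.representation_scale C)
  have repr0: "E.representation C x c = 0" if "x \<in> E" "c \<notin> B" for x c
    using E.representation_extend[OF C(1) _ C(3), of x] that B(2)
    by (metis E.representation_ne_zero)
  have inj: "inj_on g E"
  proof (rule inj_onI)
    fix x y assume xy: "x \<in> E" "y \<in> E" "g x = g y"
    have "E.representation C x c = E.representation C y c" for c
    proof (cases "c \<in> B")
      case True
      then obtain i where "c = b i" using b by blast
      then show ?thesis using xy(3) by (simp add: g_def fun_eq_iff)
    qed (use repr0 xy in auto)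
    then have eq: "E.representation C x = E.representation C y" ..
    have "x \<in> E.span C" "y \<in> E.span C" using C(2) by auto
    from this[THEN E.sum_nonzero_representation_eq[OF C(1)]]
    show "x = y" unfolding eq by (rule trans[OF sym])
  qed
  define h where "h = the_inv_into E g"
  have h: "h (g x) = x" if "x \<in> E" for x
    using inj that by (simp add: h_def the_inv_into_f_f)
  define m' where "m' x y = g (m (h x) (h y))" for x y
  have gadd: "g x + g y = g (x + y)" and gsc: "fun_scale c (g x) = g (t c x)" for x y c
    by (fact P.linear_add[OF lin, symmetric], fact P.linear_scale[OF lin, symmetric])
  have Eadd: "x + y \<in> E" and Esc: "t c x \<in> E" if "x \<in> E" "y \<in> E" for x y c
    using that E.subspace_carrier by (auto simp: E.subspace_add E.subspace_scale)
  have alg: "algebra_on fun_scale (g ` E) m'"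
  proof unfold_locales
    show "F.subspace (g ` E)"
      using P.linear_subspace_image[OF lin E.subspace_carrier] .
  qed (auto simp: m'_def h gadd gsc Eadd Esc E.mul_closed E.mul_add_left E.mul_add_right
        E.mul_scale_left E.mul_scale_right)
  have ind: "F.independent (g ` B)"
    using P.linear_independent_injective_image[OF lin B(1)] inj B(2) by simp
  have spn: "F.span (g ` B) = g ` E"
    using P.linear_span_image[OF lin] B(2) by simp
  have "evolution_algebra fun_scale (g ` E) m'"
    unfolding evolution_algebra_def is_basis_def
  proof (intro conjI exI[of _ "g ` B"] ballI impI)
    fix x y assume "x \<in> g ` B" "y \<in> g ` B" "x \<noteq> y"
    then obtain u w where u: "x = g u" "y = g w" "u \<in> B" "w \<in> B" "u \<noteq> w" by auto
    then have "h x = u" "h y = w" using BE h by auto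
    then have "m' x y = g 0" using B(3)[of u w] u by (simp add: m'_def)
    then show "m' x y = 0" using P.linear_0[OF lin] by simp
  qed (use alg ind spn in auto)
  moreover have "algebra_mono s mul fun_scale (g ` E) m' (g \<circ> f)"
  proof -
    have f: "Vector_Spaces.linear s t f" "\<And>x. f x \<in> E" "inj f" "\<And>x y. f (mul x y) = m (f x) (f y)"
      using mono by (auto simp: algebra_mono_def)
    have "Vector_Spaces.linear s fun_scale (g \<circ> f)"
      using f(1) lin by (rule Vector_Spaces.linear_compose)
    moreover have "inj (g \<circ> f)"
      using f(2,3) inj by (meson comp_inj_on image_subsetI inj_on_subset)
    ultimately show ?thesis
      using f(2,4) by (auto simp: algebra_mono_def m'_def h)
  qed
  ultimately have "edim s mul \<le> edimension fun_scale (g ` E)"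
    unfolding edim_def by (intro Inf_lower) blast
  also have "edimension fun_scale (g ` E) = edimension t E"
  proof -
    have "E.dim E = card B"
      using E.dim_eq_card[of B E] B by (metis E.span_span)
    moreover have "F.dim (g ` E) = card (g ` B)"
      using F.dim_eq_card[of "g ` B" "g ` E"] ind spn by (metis F.span_span)
    moreover have "card (g ` B) = card B"
      using inj BE by (metis card_image inj_on_subset)
    moreover have "\<exists>D. finite D \<and> g ` E \<subseteq> F.span D"
      using finB spn by (intro exI[of _ "g ` B"]) auto
    ultimately show ?thesis using True by (simp add: edimension_def)
  qed
  finally show ?thesis .
qed

end

(* Polarization turns a Waring decomposition of x^2 into an expansion
   xy = \<Sum> l_k(x) l_k(y) v_k of the product. Such an expansion with injective associated map L is the
   same as an embedding of A into an evolution algebra on F^m: put e_k e_k = L(v_k) in one direction;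
   in the other, take the coordinates of the embedding and pull the squares of the natural basis
   back along a linear left inverse. If L is injective, then for every subspace W some dim W of the
   functionals restrict to a basis of the dual of W. For W = A these are the coordinates of a basis
   and contribute only to its squares; for W = Ann(A) they can be dropped after projecting along W. *)

theory Submission
  imports Defs
begin

section \<open>Linear functionals and infima of sets of lengths\<close>

lemma vector_space_mult: "vector_space ((*) :: 'f::field \<Rightarrow> 'f \<Rightarrow> 'f)"
  by unfold_locales (auto simp: algebra_simps)

lemma linear_functional_iff:
  fixes s :: "'f::field \<Rightarrow> 'v::ab_group_add \<Rightarrow> 'v"
  assumes "vector_space s"
  shows "Vector_Spaces.linear s (*) f \<longleftrightarrow> (\<forall>x y. f (x + y) = f x + f y) \<and> (\<forall>c x. f (s c x) = c * f x)"
  using assms vector_space_mult by (auto simp: Vector_Spaces.linear_iff)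

text \<open>Converts a two-way translation of lengths with shift \<open>c\<close> into an equation
  between invariants. It is applied with \<open>c\<close> the dimension of the algebra and with
  \<open>c\<close> the dimension of its annihilator.\<close>

lemma enat_Inf_shift:
  assumes "\<And>m. P m \<Longrightarrow> \<exists>t. Q t \<and> c + t = m" and "\<And>t. Q t \<Longrightarrow> P (c + t)"
  shows "Inf {enat m | m. P m} = Inf {enat t | t. Q t} + enat c"
proof (rule antisym)
  show "Inf {enat m | m. P m} \<le> Inf {enat t | t. Q t} + enat c"
  proof (cases "{enat t | t. Q t} = {}")
    case False
    \<comment> \<open>By well-ordering, a nonempty set of \<open>enat\<close> contains its infimum.
      If the set is empty, the right-hand side is \<infinity> and the inequality is trivial.\<close>
    then have "Inf {enat t | t. Q t} \<in> {enat t | t. Q t}" 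
      using LeastI_ex[of "\<lambda>x. x \<in> {enat t | t. Q t}"] by (simp only: Inf_enat_def if_False) blast
    then obtain t where t: "Inf {enat t | t. Q t} = enat t" "Q t" by auto
    then have "Inf {enat m | m. P m} \<le> enat (c + t)" by (intro Inf_lower) (auto intro: assms(2))
    then show ?thesis by (simp add: t(1) add.commute)
  qed (simp add: top_enat_def)
  show "Inf {enat t | t. Q t} + enat c \<le> Inf {enat m | m. P m}"
  proof (rule Inf_greatest)
    fix e assume "e \<in> {enat m | m. P m}"
    then obtain m where m: "e = enat m" "P m" by auto
    then obtain t where t: "Q t" "c + t = m" using assms(1) by blast
    have "Inf {enat t | t. Q t} \<le> enat t" using t(1) by (intro Inf_lower) auto
    then have "Inf {enat t | t. Q t} + enat c \<le> enat t + enat c" by (rule add_right_mono)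
    then show "Inf {enat t | t. Q t} + enat c \<le> e" using m t by (simp add: add.commute)
  qed
qed

lemma ball_Plus: "(\<forall>k\<in>A <+> B. P k) \<longleftrightarrow> (\<forall>a\<in>A. P (Inl a)) \<and> (\<forall>b\<in>B. P (Inr b))"
  by auto

section \<open>Separating families of functionals and dual vectors\<close>

context vector_space
begin

lemma functional_add: "Vector_Spaces.linear scale (*) f \<Longrightarrow> f (x + y) = f x + f y"
  and functional_scale: "Vector_Spaces.linear scale (*) f \<Longrightarrow> f (scale c x) = c * f x"
  using linear_functional_iff[OF vector_space_axioms] by blast+

lemma functional_diff: "Vector_Spaces.linear scale (*) f \<Longrightarrow> f (x - y) = f x - f y"
  by (metis add_diff_cancel diff_add_cancel functional_add)

lemma functional_zero: "Vector_Spaces.linear scale (*) f \<Longrightarrow> f 0 = 0"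
  using functional_diff[of f 0 0] by simp

lemma functional_sum: "Vector_Spaces.linear scale (*) f \<Longrightarrow> f (sum g I) = (\<Sum>i\<in>I. f (g i))"
  by (induction I rule: infinite_finite_induct) (auto simp: functional_zero functional_add)

lemma linear_representation:
  assumes "independent B" "span B = UNIV"
  shows "Vector_Spaces.linear scale (*) (\<lambda>x. representation B x b)"
  using assms by (simp add: linear_functional_iff[OF vector_space_axioms] representation_add representation_scale)

text \<open>The index set \<open>D\<close> is a minimal subset of \<open>K\<close> whose functionals still separate the points of \<open>W\<close>;
  minimality yields the dual vectors.\<close>

lemma ex_dual_subfamily:
  fixes l :: "'i \<Rightarrow> 'b \<Rightarrow> 'a"
  assumes W: "subspace W" and K: "finite K"
    and lin: "\<forall>k\<in>K. Vector_Spaces.linear scale (*) (l k)"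
    and sep: "\<forall>x\<in>W. (\<forall>k\<in>K. l k x = 0) \<longrightarrow> x = 0"
  shows "\<exists>D w. D \<subseteq> K \<and> w ` D \<subseteq> W \<and> (\<forall>j\<in>D. \<forall>k\<in>D. l k (w j) = (if j = k then 1 else 0)) \<and>
    independent (w ` D) \<and> span (w ` D) = W \<and> card D = dim W"
proof -
  define separates where "separates D \<longleftrightarrow> (\<forall>x\<in>W. (\<forall>k\<in>D. l k x = 0) \<longrightarrow> x = 0)" for D
  have "separates K" using sep by (auto simp: separates_def)
  then obtain D where D: "D \<subseteq> K" "separates D" and min: "\<And>D'. D' \<subset> D \<Longrightarrow> \<not> separates D'"
    using finite_has_minimal2[of "{D. D \<subseteq> K \<and> separates D}" K] K by auto (metis order.trans psubset_imp_subset psubset_eq)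
  have finD: "finite D" using D(1) K finite_subset by blast
  have "\<exists>w. w \<in> W \<and> (\<forall>k\<in>D. l k w = (if j = k then 1 else 0))" if j: "j \<in> D" for j
  proof -
    \<comment> \<open>Without \<open>j\<close> some nonzero \<open>u\<close> in \<open>W\<close> is
      killed by all remaining functionals. Since \<open>D\<close> separates, \<open>l j u\<close> is
      nonzero, so \<open>u\<close> can be rescaled to the dual vector of \<open>j\<close>.\<close>
    have "\<not> separates (D - {j})" using min j by blast
    then obtain u where u: "u \<in> W" "\<And>k. k \<in> D - {j} \<Longrightarrow> l k u = 0" "u \<noteq> 0"
      by (auto simp: separates_def)
    then have nz: "l j u \<noteq> 0" using D(2) by (auto simp: separates_def)
    have "l k (scale (1 / l j u) u) = (if j = k then 1 else 0)" if "k \<in> D" for k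
      using u nz that D(1) lin by (auto simp: functional_scale)
    then show ?thesis using u(1) W subspace_scale by blast
  qed
  then obtain w where w: "\<And>j. j \<in> D \<Longrightarrow> w j \<in> W"
    "\<And>j k. j \<in> D \<Longrightarrow> k \<in> D \<Longrightarrow> l k (w j) = (if j = k then 1 else 0)" by metis
  have coeff: "l k (\<Sum>j\<in>D. scale (c j) (w j)) = c k" if "k \<in> D" for k c
  proof -
    have "l k (\<Sum>j\<in>D. scale (c j) (w j)) = (\<Sum>j\<in>D. c j * (if j = k then 1 else 0))"
      using that D(1) lin w(2) by (simp add: functional_sum functional_scale subset_iff)
    also have "\<dots> = c k" using that finD by (simp add: if_distrib cong: if_cong)
    finally show ?thesis .
  qed
  \<comment> \<open>The remainder lies in \<open>W\<close> and is killed by every functional in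
    \<open>D\<close>, hence is zero. This gives the spanning property.\<close>
  have expand: "x = (\<Sum>k\<in>D. scale (l k x) (w k))" if "x \<in> W" for x
  proof -
    have "x - (\<Sum>k\<in>D. scale (l k x) (w k)) \<in> W"
      using that W w(1) by (intro subspace_diff subspace_sum subspace_scale) auto
    moreover have "\<forall>k\<in>D. l k (x - (\<Sum>k\<in>D. scale (l k x) (w k))) = 0"
      using D(1) lin by (auto simp: functional_diff coeff)
    ultimately show ?thesis using D(2) by (auto simp: separates_def)
  qed
  have inj: "inj_on w D" by (rule inj_onI) (metis w(2) zero_neq_one)
  have ind: "independent (w ` D)"
  proof (rule independent_if_scalars_zero)
    fix f x assume "(\<Sum>x\<in>w ` D. scale (f x) x) = 0" "x \<in> w ` D"
    then obtain k where k: "k \<in> D" "x = w k" "(\<Sum>j\<in>D. scale (f (w j)) (w j)) = 0"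
      using inj by (auto simp: sum.reindex)
    then show "f x = 0" using coeff[of k "\<lambda>j. f (w j)"] D(1) lin functional_zero by fastforce
  qed (use finD in auto)
  have spn: "span (w ` D) = W"
  proof
    show "span (w ` D) \<subseteq> W" using w(1) W by (intro span_minimal) auto
    show "W \<subseteq> span (w ` D)"
    proof
      fix x assume "x \<in> W"
      then show "x \<in> span (w ` D)" by (subst expand) (auto intro!: span_sum intro: span_scale span_base)
    qed
  qed
  have "card D = dim W"
    using dim_eq_card[of "w ` D" W] ind spn inj by (metis card_image span_span)
  then show ?thesis using D(1) w ind spn by blast
qed

end

section \<open>Products in terms of a natural basis\<close>

context algebra_on
begin

lemma mul_zero_left: "y \<in> E \<Longrightarrow> mul 0 y = 0"
  and mul_zero_right: "y \<in> E \<Longrightarrow> mul y 0 = 0"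
  using mul_scale_left[of 0 y 0] mul_scale_right[of y 0 0] subspace_0[OF subspace_carrier] by auto

lemma mul_sum_left: "(\<And>i. i \<in> I \<Longrightarrow> u i \<in> E) \<Longrightarrow> y \<in> E \<Longrightarrow> mul (\<Sum>i\<in>I. u i) y = (\<Sum>i\<in>I. mul (u i) y)"
  by (induction I rule: infinite_finite_induct)
    (auto simp: mul_zero_left mul_add_left subspace_sum[OF subspace_carrier])

lemma mul_sum_right: "(\<And>i. i \<in> I \<Longrightarrow> u i \<in> E) \<Longrightarrow> y \<in> E \<Longrightarrow> mul y (\<Sum>i\<in>I. u i) = (\<Sum>i\<in>I. mul y (u i))"
  by (induction I rule: infinite_finite_induct)
    (auto simp: mul_zero_right mul_add_right subspace_sum[OF subspace_carrier])

text \<open>Bilinearity expands the product into a double sum whose mixed terms vanish by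
  orthogonality. This is how the coordinates of an embedding produce a diagonal expansion.\<close>

lemma mul_natural_basis:
  assumes B: "finite B" "B \<subseteq> E" and orth: "\<And>b c. b \<in> B \<Longrightarrow> c \<in> B \<Longrightarrow> b \<noteq> c \<Longrightarrow> mul b c = 0"
  shows "mul (\<Sum>b\<in>B. s (p b) b) (\<Sum>b\<in>B. s (q b) b) = (\<Sum>b\<in>B. s (p b * q b) (mul b b))"
proof -
  have sc: "s c b \<in> E" if "b \<in> B" for b c using that B(2) subspace_scale[OF subspace_carrier] by blast
  have "mul (\<Sum>b\<in>B. s (p b) b) (\<Sum>c\<in>B. s (q c) c) = (\<Sum>b\<in>B. \<Sum>c\<in>B. mul (s (p b) b) (s (q c) c))"
    using sc by (simp add: mul_sum_left mul_sum_right subspace_sum[OF subspace_carrier]) (rule sum.swap)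
  also have "\<dots> = (\<Sum>b\<in>B. \<Sum>c\<in>B. if c = b then s (p b * q b) (mul b b) else 0)"
    using sc B(2) by (intro sum.cong) (auto simp: mul_scale_left mul_scale_right orth subset_iff)
  also have "\<dots> = (\<Sum>b\<in>B. s (p b * q b) (mul b b))" using B(1) by simp
  finally show ?thesis .
qed

end

section \<open>Expansions of the product and the invariants they define\<close>

locale commutative_algebra = finite_dimensional_vector_space s Basis + algebra_on s "UNIV :: 'v set" mul
  for s :: "'f::field \<Rightarrow> 'v::ab_group_add \<Rightarrow> 'v" and Basis mul +
  assumes two_nonzero: "(2 :: 'f) \<noteq> 0" and mul_commute: "mul x y = mul y x"
begin

text \<open>The polarized form of a Waring decomposition. The index type is arbitrary because
  expansions will be indexed by bases, by disjoint sums and by complements of index sets.\<close>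

definition diagonal_expansion :: "'i set \<Rightarrow> ('i \<Rightarrow> 'v \<Rightarrow> 'f) \<Rightarrow> ('i \<Rightarrow> 'v) \<Rightarrow> bool" where
  "diagonal_expansion K l v \<longleftrightarrow> (\<forall>k\<in>K. Vector_Spaces.linear s (*) (l k)) \<and>
     (\<forall>x y. mul x y = (\<Sum>k\<in>K. s (l k x * l k y) (v k)))"

text \<open>For linear \<open>l\<close> this says that the associated linear map has trivial kernel,
  that is, that it is injective.\<close>

definition separating :: "'i set \<Rightarrow> ('i \<Rightarrow> 'v \<Rightarrow> 'f) \<Rightarrow> bool" where
  "separating K l \<longleftrightarrow> (\<forall>x. (\<forall>k\<in>K. l k x = 0) \<longrightarrow> x = 0)"

definition off_diagonal_expansion :: "'v set \<Rightarrow> 'i set \<Rightarrow> ('i \<Rightarrow> 'v \<Rightarrow> 'f) \<Rightarrow> ('i \<Rightarrow> 'v) \<Rightarrow> bool" where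
  "off_diagonal_expansion B K l v \<longleftrightarrow> is_basis s UNIV B \<and> (\<forall>k\<in>K. Vector_Spaces.linear s (*) (l k)) \<and>
     (\<forall>b\<in>B. \<forall>c\<in>B. b \<noteq> c \<longrightarrow> mul b c = (\<Sum>k\<in>K. s (l k b * l k c) (v k)))"

text \<open>This predicate and the next two speak of attained lengths, not of minimal ones. The
  invariants are their infima, so comparing invariants reduces to converting lengths.\<close>

definition waring_length :: "nat \<Rightarrow> bool" where
  "waring_length m \<longleftrightarrow> (\<exists>l v. diagonal_expansion {..<m} l v)"

definition injective_waring_length :: "nat \<Rightarrow> bool" where
  "injective_waring_length m \<longleftrightarrow> (\<exists>l v. diagonal_expansion {..<m} l v \<and> separating {..<m} l)"

definition off_diagonal_length :: "nat \<Rightarrow> bool" where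
  "off_diagonal_length m \<longleftrightarrow> (\<exists>B l v. off_diagonal_expansion B {..<m} l v)"

text \<open>Polarization: by commutativity \<open>2xy = (x + y)^2 - x^2 - y^2\<close>, and the
  squares of functionals satisfy the same identity. Cancelling the nonzero factor 2 recovers the
  product from the squaring map.\<close>

lemma waring_decomposition_iff:
  "waring_decomposition s (\<lambda>x. mul x x) m l v \<longleftrightarrow> diagonal_expansion {..<m} l v"
proof
  assume L: "waring_decomposition s (\<lambda>x. mul x x) m l v"
  then have lin: "\<And>k. k < m \<Longrightarrow> Vector_Spaces.linear s (*) (l k)"
    and sq: "\<And>x. mul x x = (\<Sum>k<m. s ((l k x)\<^sup>2) (v k))" by (auto simp: waring_decomposition_def)
  have "mul x y = (\<Sum>k<m. s (l k x * l k y) (v k))" for x y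
  proof -
    have "s 2 (mul x y) = mul x y + mul y x"
      by (simp only: mul_commute[of y x]) (metis one_add_one scale_left_distrib scale_one)
    also have "\<dots> = mul (x + y) (x + y) - mul x x - mul y y"
      by (simp add: mul_add_left mul_add_right)
    also have "\<dots> = (\<Sum>k<m. s ((l k (x + y))\<^sup>2 - (l k x)\<^sup>2 - (l k y)\<^sup>2) (v k))"
      by (simp add: sq sum_subtractf scale_left_diff_distrib)
    also have "\<dots> = (\<Sum>k<m. s (2 * (l k x * l k y)) (v k))"
      by (intro sum.cong) (auto simp: functional_add lin power2_eq_square algebra_simps)
    also have "\<dots> = s 2 (\<Sum>k<m. s (l k x * l k y) (v k))" by (simp add: scale_sum_right)
    finally show ?thesis using two_nonzero by simp
  qed
  then show "diagonal_expansion {..<m} l v" using lin by (auto simp: diagonal_expansion_def)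
next
  assume "diagonal_expansion {..<m} l v"
  then show "waring_decomposition s (\<lambda>x. mul x x) m l v"
    by (auto simp: waring_decomposition_def diagonal_expansion_def power2_eq_square)
qed

lemma inj_associated_map_iff:
  assumes "diagonal_expansion {..<m} l v"
  shows "inj (associated_map m l) \<longleftrightarrow> separating {..<m} l"
proof -
  have lin: "Vector_Spaces.linear s (*) (l k)" if "k < m" for k
    using assms that by (auto simp: diagonal_expansion_def)
  have eq: "associated_map m l x = associated_map m l y \<longleftrightarrow> (\<forall>k<m. l k (x - y) = 0)" for x y
    by (auto simp: associated_map_def fun_eq_iff functional_diff lin)
  show ?thesis
    unfolding inj_on_def separating_def eq by (auto dest: spec[where x = 0])
qed

lemma wr_eq: "wr s (\<lambda>x. mul x x) = Inf {enat m | m. waring_length m}"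
  by (simp add: wr_def waring_decomposition_iff waring_length_def)

lemma sr_eq: "sr s (\<lambda>x. mul x x) = Inf {enat m | m. injective_waring_length m}"
  unfolding sr_def waring_decomposition_iff injective_waring_length_def
  using inj_associated_map_iff by metis

text \<open>A minimum over bases of minima over expansions is one minimum over all pairs of a basis
  and an expansion.\<close>

lemma eps_eq: "eps s mul = Inf {enat m | m. off_diagonal_length m}"
proof (rule antisym)
  show "eps s mul \<le> Inf {enat m | m. off_diagonal_length m}"
  proof (rule Inf_greatest)
    fix e assume "e \<in> {enat m | m. off_diagonal_length m}"
    then obtain m B l v where m: "e = enat m" "off_diagonal_expansion B {..<m} l v"
      by (auto simp: off_diagonal_length_def)
    then have "eps_basis s mul B \<le> e"
      unfolding eps_basis_def by (intro Inf_lower) (auto simp: off_diagonal_expansion_def)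
    moreover have "eps s mul \<le> eps_basis s mul B"
      unfolding eps_def using m(2) by (intro Inf_lower) (auto simp: off_diagonal_expansion_def)
    ultimately show "eps s mul \<le> e" by simp
  qed
  show "Inf {enat m | m. off_diagonal_length m} \<le> eps s mul"
    unfolding eps_def eps_basis_def
  proof (safe intro!: Inf_greatest)
    fix B m v and l :: "nat \<Rightarrow> 'v \<Rightarrow> 'f"
    assume "is_basis s UNIV B" "\<forall>k<m. Vector_Spaces.linear s (*) (l k)"
      "\<forall>b\<in>B. \<forall>c\<in>B. b \<noteq> c \<longrightarrow> mul b c = (\<Sum>k<m. s (l k b * l k c) (v k))"
    then have "off_diagonal_expansion B {..<m} l v" by (simp add: off_diagonal_expansion_def)
    then show "Inf {enat m | m. off_diagonal_length m} \<le> enat m"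
      by (intro Inf_lower) (auto simp: off_diagonal_length_def)
  qed
qed

text \<open>Renumbering along a bijection lets any finite index set witness a length.\<close>

lemma waring_lengthI:
  assumes "finite K" "diagonal_expansion K l v"
  shows "waring_length (card K)"
    and "separating K l \<Longrightarrow> injective_waring_length (card K)"
proof -
  obtain g where g: "bij_betw g {..<card K} K"
    using ex_bij_betw_nat_finite[OF assms(1)] by (auto simp: atLeast0LessThan)
  have "diagonal_expansion {..<card K} (l \<circ> g) (v \<circ> g)"
    using assms(2) bij_betwE[OF g] unfolding diagonal_expansion_def
    by (auto simp: sum.reindex_bij_betw[OF g, symmetric])
  moreover have "separating {..<card K} (l \<circ> g)" if "separating K l"
    unfolding separating_def
  proof (intro allI impI)
    fix x assume "\<forall>i\<in>{..<card K}. (l \<circ> g) i x = 0"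
    then have "\<forall>k\<in>g ` {..<card K}. l k x = 0" by simp
    then show "x = 0" using that by (simp add: bij_betw_imp_surj_on[OF g] separating_def)
  qed
  ultimately show "waring_length (card K)" "separating K l \<Longrightarrow> injective_waring_length (card K)"
    unfolding waring_length_def injective_waring_length_def by blast+
qed

lemma off_diagonal_lengthI:
  assumes "finite K" "off_diagonal_expansion B K l v"
  shows "off_diagonal_length (card K)"
proof -
  obtain g where g: "bij_betw g {..<card K} K"
    using ex_bij_betw_nat_finite[OF assms(1)] by (auto simp: atLeast0LessThan)
  have "off_diagonal_expansion B {..<card K} (l \<circ> g) (v \<circ> g)"
    using assms(2) bij_betwE[OF g] unfolding off_diagonal_expansion_def
    by (auto simp: sum.reindex_bij_betw[OF g, symmetric])
  then show ?thesis unfolding off_diagonal_length_def by blast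
qed

section \<open>Off-diagonal expansions and the shift by the dimension\<close>

lemma basis_facts:
  assumes "is_basis s UNIV B"
  shows "independent B" "span B = UNIV" "finite B" "card B = dim UNIV"
  using assms dim_eq_card[of B UNIV] by (auto simp: is_basis_def finiteI_independent)

text \<open>Both sides are bilinear, so agreement on pairs from a spanning set extends to all pairs,
  first in the left argument and then in the right one.\<close>

lemma mul_eq_on_basis:
  assumes B: "span B = UNIV" and l: "\<And>k. k \<in> K \<Longrightarrow> Vector_Spaces.linear s (*) (l k)"
    and eq: "\<And>b c. b \<in> B \<Longrightarrow> c \<in> B \<Longrightarrow> mul b c = (\<Sum>k\<in>K. s (l k b * l k c) (v k))"
  shows "mul x y = (\<Sum>k\<in>K. s (l k x * l k y) (v k))"
proof -
  \<comment> \<open>The factor \<open>c\<close> is arbitrary, so these facts serve the left argument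
    directly and the right one after \<open>mult.commute\<close>.\<close>
  have add: "(\<Sum>k\<in>K. s (l k (x + y) * c k) (v k)) = (\<Sum>k\<in>K. s (l k x * c k) (v k)) + (\<Sum>k\<in>K. s (l k y * c k) (v k))" for x y c
    by (simp add: l functional_add algebra_simps sum.distrib)
  have sc: "(\<Sum>k\<in>K. s (l k (s r x) * c k) (v k)) = s r (\<Sum>k\<in>K. s (l k x * c k) (v k))" for x r c
    by (simp add: l functional_scale algebra_simps scale_sum_right)
  have z: "(\<Sum>k\<in>K. s (l k 0 * c k) (v k)) = 0" for c
    by (simp add: l functional_zero)
  have left: "mul x c = (\<Sum>k\<in>K. s (l k x * l k c) (v k))" if "c \<in> B" for x c
  proof -
    have "x \<in> span B" using B by simp
    then show ?thesis
      by (induction rule: span_induct_alt)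
        (auto simp: mul_zero_left mul_add_left mul_scale_left add sc z eq that)
  qed
  have "y \<in> span B" using B by simp
  then show ?thesis
  proof (induction rule: span_induct_alt)
    case base
    then show ?case using z[of "\<lambda>k. l k x"] by (simp add: mul_zero_right mult.commute)
  next
    case (step r b y)
    have "mul x (s r b + y) = s r (mul x b) + mul x y"
      by (simp add: mul_add_right mul_scale_right)
    also have "\<dots> = (\<Sum>k\<in>K. s (l k (s r b + y) * l k x) (v k))"
      unfolding add sc left[OF step(1)] step(2) by (simp add: mult.commute)
    finally show ?case by (simp add: mult.commute)
  qed
qed

text \<open>For \<open>b \<noteq> c\<close> the functional \<open>\<beta>(x) = x\<^sub>b + x\<^sub>c\<close> gives \<open>\<beta>(p) \<beta>(q) = 1\<close> on distinct basis vectors \<open>p, q\<close> if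
  \<open>{p, q} = {b, c}\<close>, and \<open>0\<close> otherwise; \<open>K\<close> consists of ordered pairs, whence the factor \<open>1 / 2\<close>.\<close>

lemma ex_off_diagonal_length: "\<exists>m. off_diagonal_length m"
proof -
  obtain B where B: "is_basis s UNIV B"
    using independent_Basis span_Basis by (auto simp: is_basis_def)
  note B' = basis_facts[OF B]
  let ?R = "representation B"
  define K where "K = {(b, c). b \<in> B \<and> c \<in> B \<and> b \<noteq> c}"
  have finK: "finite K" by (rule finite_subset[of _ "B \<times> B"]) (use B'(3) in \<open>auto simp: K_def\<close>)
  define l where "l = (\<lambda>(b, c) x. ?R x b + ?R x c)"
  define v where "v = (\<lambda>(b, c). s (1 / 2) (mul b c))"
  have "mul b c = (\<Sum>k\<in>K. s (l k b * l k c) (v k))" if bc: "b \<in> B" "c \<in> B" "b \<noteq> c" for b c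
  proof -
    have "(\<Sum>k\<in>K. s (l k b * l k c) (v k)) = (\<Sum>k\<in>{(b, c), (c, b)}. s (l k b * l k c) (v k))"
      using finK bc by (intro sum.mono_neutral_right)
        (auto simp: K_def l_def representation_basis[OF B'(1)] split: if_splits)
    also have "\<dots> = s (1 / 2) (mul b c) + s (1 / 2) (mul c b)"
      using bc by (simp add: l_def v_def representation_basis[OF B'(1)])
    also have "\<dots> = mul b c"
      using two_nonzero by (simp add: mul_commute[of c b] flip: scale_left_distrib)
    finally show ?thesis ..
  qed
  moreover have "Vector_Spaces.linear s (*) (l k)" for k
    by (cases k) (auto simp: l_def linear_functional_iff[OF vector_space_axioms] representation_add
        representation_scale B'(1,2) algebra_simps)
  ultimately have "off_diagonal_expansion B K l v" using B by (auto simp: off_diagonal_expansion_def)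
  then show ?thesis using off_diagonal_lengthI finK by blast
qed

text \<open>The coordinate functionals of the basis are adjoined to the given ones. They separate
  points, and they affect only squares of basis vectors, so the vector attached to \<open>b\<close>
  can be chosen as the error of the off-diagonal sum at \<open>mul b b\<close>.\<close>

lemma injective_waring_length_add_dim:
  assumes "off_diagonal_length t"
  shows "injective_waring_length (dim UNIV + t)"
proof -
  obtain B \<beta> w where O: "off_diagonal_expansion B {..<t} \<beta> w"
    using assms by (auto simp: off_diagonal_length_def)
  then have B: "is_basis s UNIV B" by (simp add: off_diagonal_expansion_def)
  note B' = basis_facts[OF B]
  let ?R = "representation B"
  define l where "l = case_sum (\<lambda>b x. ?R x b) \<beta>"
  define v where "v = case_sum (\<lambda>b. mul b b - (\<Sum>k<t. s (\<beta> k b * \<beta> k b) (w k))) w"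
  have lin: "Vector_Spaces.linear s (*) (l k)" if "k \<in> B <+> {..<t}" for k
    using that O B' by (auto simp: l_def off_diagonal_expansion_def linear_representation)
  have split: "(\<Sum>k\<in>B <+> {..<t}. s (l k x * l k y) (v k)) =
     (\<Sum>b\<in>B. s (?R x b * ?R y b) (v (Inl b))) + (\<Sum>k<t. s (\<beta> k x * \<beta> k y) (w k))" for x y
    using B'(3) by (simp add: sum.Plus l_def v_def)
  have on_basis: "mul b c = (\<Sum>k\<in>B <+> {..<t}. s (l k b * l k c) (v k))" if "b \<in> B" "c \<in> B" for b c
  proof -
    \<comment> \<open>On basis vectors the coordinates are Kronecker deltas, so only
      \<open>a = b = c\<close> contributes.\<close>
    have "(\<Sum>a\<in>B. s (?R b a * ?R c a) (v (Inl a))) = (\<Sum>a\<in>B. if a = b then (if b = c then v (Inl b) else 0) else 0)"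
      using that by (intro sum.cong) (auto simp: representation_basis[OF B'(1)])
    also have "\<dots> = (if b = c then v (Inl b) else 0)" using that B'(3) by simp
    finally have diag: "(\<Sum>a\<in>B. s (?R b a * ?R c a) (v (Inl a))) = (if b = c then v (Inl b) else 0)" .
    show ?thesis unfolding split diag using that O by (auto simp: v_def off_diagonal_expansion_def)
  qed
  have "diagonal_expansion (B <+> {..<t}) l v"
    unfolding diagonal_expansion_def using lin mul_eq_on_basis[OF B'(2) lin on_basis] by blast
  moreover have "separating (B <+> {..<t}) l"
    unfolding separating_def
  proof (intro allI impI)
    fix x assume "\<forall>k\<in>B <+> {..<t}. l k x = 0"
    then have "\<forall>b\<in>B. ?R x b = 0" by (simp add: ball_Plus l_def)
    then show "x = 0" using sum_representation_eq[OF B'(1) _ B'(3) order.refl, of x] B'(2) by simp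
  qed
  ultimately have "injective_waring_length (card (B <+> {..<t}))"
    by (rule waring_lengthI(2)[OF finite_Plus[OF B'(3) finite_lessThan]])
  then show ?thesis using B'(3,4) by (simp add: card_Plus)
qed

text \<open>Some \<open>dim A\<close> of the functionals form the dual basis of a basis \<open>B\<close>; their terms in the
  expansion of a product of distinct elements of \<open>B\<close> vanish.\<close>

lemma off_diagonal_length_diff_dim:
  assumes "injective_waring_length m"
  shows "\<exists>t. off_diagonal_length t \<and> dim UNIV + t = m"
proof -
  obtain l v where lv: "diagonal_expansion {..<m} l v" "separating {..<m} l"
    using assms by (auto simp: injective_waring_length_def)
  then have lin: "Vector_Spaces.linear s (*) (l k)" if "k \<in> {..<m}" for k
    using that by (auto simp: diagonal_expansion_def)
  have sep: "\<forall>x\<in>UNIV. (\<forall>k\<in>{..<m}. l k x = 0) \<longrightarrow> x = 0"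
    using lv(2) by (simp add: separating_def)
  have lin': "\<forall>k\<in>{..<m}. Vector_Spaces.linear s (*) (l k)"
    using lin by blast
  obtain D w where D: "D \<subseteq> {..<m}" "w ` D \<subseteq> UNIV"
    "\<forall>j\<in>D. \<forall>k\<in>D. l k (w j) = (if j = k then 1 else 0)"
    "independent (w ` D)" "span (w ` D) = UNIV" "card D = dim UNIV"
    using ex_dual_subfamily[OF subspace_UNIV finite_lessThan lin' sep] by (elim exE conjE) (rule that)
  have "off_diagonal_expansion (w ` D) ({..<m} - D) l v"
    unfolding off_diagonal_expansion_def
  proof (intro conjI ballI impI)
    fix b c assume bc: "b \<in> w ` D" "c \<in> w ` D" "b \<noteq> c"
    have "mul b c = (\<Sum>k<m. s (l k b * l k c) (v k))" using lv(1) by (simp add: diagonal_expansion_def)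
    also have "\<dots> = (\<Sum>k\<in>{..<m} - D. s (l k b * l k c) (v k))"
      using bc D(3) by (intro sum.mono_neutral_right) (auto split: if_splits)
    finally show "mul b c = (\<Sum>k\<in>{..<m} - D. s (l k b * l k c) (v k))" .
  qed (use D lin in \<open>auto simp: is_basis_def\<close>)
  then have "off_diagonal_length (card ({..<m} - D))" by (intro off_diagonal_lengthI) auto
  moreover have "dim UNIV + card ({..<m} - D) = m"
    using D(1,6) card_mono[OF _ D(1)] by (simp add: card_Diff_subset finite_subset)
  ultimately show ?thesis by blast
qed

section \<open>The annihilator and the Waring rank\<close>

lemma subspace_Ann: "subspace (Ann mul)"
  by (auto simp: subspace_def Ann_def mul_zero_left mul_add_left mul_scale_left)

text \<open>A point killed by all functionals of a diagonal expansion lies in the annihilator. It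
  therefore suffices to adjoin functionals that separate the points of \<open>Ann mul\<close>; with
  coefficient vector 0 they leave the expansion unchanged.\<close>

lemma injective_waring_length_add_Ann:
  assumes "waring_length t"
  shows "injective_waring_length (dim (Ann mul) + t)"
proof -
  obtain \<beta> w where O: "diagonal_expansion {..<t} \<beta> w"
    using assms by (auto simp: waring_length_def)
  obtain C where C: "C \<subseteq> Ann mul" "independent C" "Ann mul \<subseteq> span C" "card C = dim (Ann mul)"
    by (rule basis_exists)
  define B where "B = extend_basis C"
  have B: "independent B" "span B = UNIV" "C \<subseteq> B"
    using C(2) independent_extend_basis extend_basis_superset by (auto simp: B_def)
  have finC: "finite C" using C(2) finiteI_independent by blast
  let ?R = "representation B"
  define l where "l = case_sum (\<lambda>b x. ?R x b) \<beta>"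
  define v where "v = case_sum (\<lambda>b::'v. 0) w"
  have "diagonal_expansion (C <+> {..<t}) l v"
    using O B finC unfolding diagonal_expansion_def
    by (auto simp: sum.Plus l_def v_def linear_representation)
  moreover have "separating (C <+> {..<t}) l"
    unfolding separating_def
  proof (intro allI impI)
    fix x assume x: "\<forall>k\<in>C <+> {..<t}. l k x = 0"
    then have "\<forall>k<t. \<beta> k x = 0" by (simp add: ball_Plus l_def)
    then have "x \<in> Ann mul" using O by (auto simp: diagonal_expansion_def Ann_def)
    then have xC: "x \<in> span C" using C(3) by blast
    \<comment> \<open>On \<open>span C\<close> the coordinates with respect to \<open>B\<close> and
      to \<open>C\<close> agree.\<close>
    have "\<forall>b\<in>C. representation C x b = 0"
      using x representation_extend[OF B(1) xC B(3)] by (simp add: ball_Plus l_def)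
    then show "x = 0" using sum_representation_eq[OF C(2) xC finC order.refl] by simp
  qed
  ultimately have "injective_waring_length (card (C <+> {..<t}))"
    by (rule waring_lengthI(2)[OF finite_Plus[OF finC finite_lessThan]])
  then show ?thesis using finC C(4) by (simp add: card_Plus)
qed

text \<open>Some \<open>dim (Ann A)\<close> of the functionals restrict to a basis of the dual of \<open>Ann A\<close>; the projection
  \<open>\<pi>\<close> along \<open>Ann A\<close> onto their common kernel does not change products.\<close>

lemma waring_length_diff_Ann:
  assumes "injective_waring_length m"
  shows "\<exists>t. waring_length t \<and> dim (Ann mul) + t = m"
proof -
  obtain l v where lv: "diagonal_expansion {..<m} l v" "separating {..<m} l"
    using assms by (auto simp: injective_waring_length_def)
  then have lin: "Vector_Spaces.linear s (*) (l k)" if "k \<in> {..<m}" for k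
    using that by (auto simp: diagonal_expansion_def)
  have sep: "\<forall>x\<in>Ann mul. (\<forall>k\<in>{..<m}. l k x = 0) \<longrightarrow> x = 0"
    using lv(2) by (simp add: separating_def)
  have lin': "\<forall>k\<in>{..<m}. Vector_Spaces.linear s (*) (l k)"
    using lin by blast
  obtain D w where D: "D \<subseteq> {..<m}" "w ` D \<subseteq> Ann mul"
    "\<forall>j\<in>D. \<forall>k\<in>D. l k (w j) = (if j = k then 1 else 0)"
    "independent (w ` D)" "span (w ` D) = Ann mul" "card D = dim (Ann mul)"
    using ex_dual_subfamily[OF subspace_Ann finite_lessThan lin' sep] by (elim exE conjE) (rule that)
  have finD: "finite D" using D(1) finite_subset by blast
  define \<pi> where "\<pi> x = x - (\<Sum>k\<in>D. s (l k x) (w k))" for x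
  have \<pi>_add: "\<pi> (x + y) = \<pi> x + \<pi> y" for x y
    using D(1) by (simp add: \<pi>_def functional_add lin subset_iff scale_left_distrib sum.distrib)
  have \<pi>_scale: "\<pi> (s c x) = s c (\<pi> x)" for c x
    using D(1) by (simp add: \<pi>_def functional_scale lin subset_iff scale_right_diff_distrib scale_sum_right)
  have kernel: "l k (\<pi> x) = 0" if "k \<in> D" for k x
  proof -
    have "l k (\<pi> x) = l k x - (\<Sum>j\<in>D. l j x * (if j = k then 1 else 0))"
      using that D(1,3) lin by (simp add: \<pi>_def functional_diff functional_sum functional_scale subset_iff)
    also have "\<dots> = 0" using that finD by (simp add: if_distrib cong: if_cong)
    finally show ?thesis .
  qed
  have "x - \<pi> x \<in> Ann mul" for x
    using D(2) by (auto simp: \<pi>_def intro!: subspace_sum subspace_scale subspace_Ann)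
  then have left: "mul (\<pi> x) y = mul x y" for x y
    using mul_add_left[of "x - \<pi> x" "\<pi> x" y] by (simp add: Ann_def)
  have "mul x y = (\<Sum>k\<in>{..<m} - D. s (l k (\<pi> x) * l k (\<pi> y)) (v k))" for x y
  proof -
    have "mul x y = mul (\<pi> x) (\<pi> y)" by (metis left mul_commute)
    also have "\<dots> = (\<Sum>k<m. s (l k (\<pi> x) * l k (\<pi> y)) (v k))" using lv(1) by (simp add: diagonal_expansion_def)
    also have "\<dots> = (\<Sum>k\<in>{..<m} - D. s (l k (\<pi> x) * l k (\<pi> y)) (v k))"
      by (intro sum.mono_neutral_right) (auto simp: kernel)
    finally show ?thesis .
  qed
  moreover have "Vector_Spaces.linear s (*) (\<lambda>x. l k (\<pi> x))" if "k \<in> {..<m}" for k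
    using lin[OF that] by (simp add: linear_functional_iff[OF vector_space_axioms] \<pi>_add \<pi>_scale)
  ultimately have "diagonal_expansion ({..<m} - D) (\<lambda>k x. l k (\<pi> x)) v"
    by (auto simp: diagonal_expansion_def)
  then have "waring_length (card ({..<m} - D))" by (intro waring_lengthI) auto
  moreover have "dim (Ann mul) + card ({..<m} - D) = m"
    using D(1,6) card_mono[OF _ D(1)] by (simp add: card_Diff_subset finite_subset)
  ultimately show ?thesis by blast
qed

section \<open>Embeddings into evolution algebras\<close>

text \<open>The functionals are the coordinates of \<open>f x\<close> in the natural basis; they
  separate points because \<open>f\<close> is injective, and there are as many as the dimension of
  \<open>E\<close>.\<close>

lemma injective_waring_length_dim_evolution_algebra:
  fixes t :: "'f \<Rightarrow> 'w::ab_group_add \<Rightarrow> 'w"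
  assumes ev: "evolution_algebra t E mul'" and mono: "algebra_mono s mul t E mul' f"
    and fin: "finite S" "E \<subseteq> module.span t S"
  shows "injective_waring_length (vector_space.dim t E)"
proof -
  interpret E: algebra_on t E mul' using ev by (simp add: evolution_algebra_def)
  interpret P: vector_space_pair s t by unfold_locales
  obtain B where B: "E.independent B" "E.span B = E"
    and orth: "\<And>x y. x \<in> B \<Longrightarrow> y \<in> B \<Longrightarrow> x \<noteq> y \<Longrightarrow> mul' x y = 0"
    using ev by (auto simp: evolution_algebra_def is_basis_def)
  have BE: "B \<subseteq> E" using B(2) E.span_superset by blast
  have finB: "finite B" using fin B(1) BE E.independent_span_bound by (meson order.trans)
  have f: "Vector_Spaces.linear s t f" "\<And>x. f x \<in> E" "inj f" "\<And>x y. f (mul x y) = mul' (f x) (f y)"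
    using mono by (auto simp: algebra_mono_def)
  \<comment> \<open>Squares of natural basis vectors may lie outside the image of \<open>f\<close>,
    so they are pulled back by a left inverse that is linear on the whole target space.\<close>
  obtain g where g: "Vector_Spaces.linear t s g" "\<And>x. g (f x) = x"
    using P.linear_injective_left_inverse[OF f(1,3)] by (auto simp: fun_eq_iff)
  interpret g: Vector_Spaces.linear t s g by (fact g(1))
  define l where "l b x = E.representation B (f x) b" for b x
  have f_expand: "f x = (\<Sum>b\<in>B. t (l b x) b)" for x
    unfolding l_def using E.sum_representation_eq[OF B(1) _ finB order.refl] B(2) f(2) by simp
  have "mul x y = (\<Sum>b\<in>B. s (l b x * l b y) (g (mul' b b)))" for x y
  proof -
    have "mul x y = g (mul' (f x) (f y))" by (simp add: g(2) flip: f(4))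
    also have "\<dots> = g (\<Sum>b\<in>B. t (l b x * l b y) (mul' b b))"
      unfolding f_expand using E.mul_natural_basis[OF finB BE orth] by simp
    finally show ?thesis by (simp add: g.sum g.scale)
  qed
  moreover have "Vector_Spaces.linear s (*) (l b)" for b
    using f(1,2) B by (auto simp: l_def linear_functional_iff[OF vector_space_axioms]
        E.representation_add E.representation_scale P.linear_add P.linear_scale)
  ultimately have "diagonal_expansion B l (\<lambda>b. g (mul' b b))" by (auto simp: diagonal_expansion_def)
  moreover have "separating B l"
    unfolding separating_def
  proof (intro allI impI)
    fix x assume "\<forall>b\<in>B. l b x = 0"
    then have "f x = f 0" using f_expand[of x] P.linear_0[OF f(1)] by simp
    then show "x = 0" using f(3) by (simp add: inj_eq)
  qed
  moreover have "E.dim E = card B" using E.dim_eq_card[of B E] B by (metis E.span_span)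
  ultimately show ?thesis using waring_lengthI(2)[OF finB] by simp
qed

lemma edim_le_injective_waring_length:
  assumes "injective_waring_length m"
  shows "edim s mul \<le> enat m"
proof -
  obtain l v where lv: "diagonal_expansion {..<m} l v" "separating {..<m} l"
    using assms by (auto simp: injective_waring_length_def)
  then have lin: "Vector_Spaces.linear s (*) (l k)" if "k < m" for k
    using that by (auto simp: diagonal_expansion_def)
  interpret F: vector_space "fun_scale :: 'f \<Rightarrow> _" by (rule vector_space_fun_scale)
  \<comment> \<open>\<open>E\<close> is the copy of F^m inside the sequence space, and the vectors
    \<open>e k\<close> with \<open>k < m\<close> will be its natural basis.\<close>
  define E :: "(nat \<Rightarrow> 'f) set" where "E = {p. \<forall>i\<ge>m. p i = 0}"
  define L where "L = associated_map m l"
  have L_apply: "L x i = (if i < m then l i x else 0)" for x i by (simp add: L_def associated_map_def)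
  have linL: "Vector_Spaces.linear s fun_scale L"
    unfolding Vector_Spaces.linear_iff using vector_space_axioms vector_space_fun_scale
    by (simp add: fun_eq_iff L_apply fun_scale_def lin functional_add functional_scale)
  \<comment> \<open>The bilinear product for which distinct \<open>e k\<close> are orthogonal and
    \<open>e k\<close> has square \<open>L (v k)\<close> for \<open>k < m\<close>. With this choice,
    applying \<open>L\<close> to the expansion of \<open>mul x y\<close> gives exactly the product
    of \<open>L x\<close> and \<open>L y\<close>.\<close>
  define mul' :: "(nat \<Rightarrow> 'f) \<Rightarrow> (nat \<Rightarrow> 'f) \<Rightarrow> nat \<Rightarrow> 'f"
    where "mul' p q = (\<lambda>i. \<Sum>k<m. p k * q k * L (v k) i)" for p q
  define e :: "nat \<Rightarrow> nat \<Rightarrow> 'f" where "e k = (\<lambda>i. if i = k then 1 else 0)" for k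
  have subE: "F.subspace E" by (auto simp: E_def F.subspace_def fun_scale_def)
  have alg: "algebra_on fun_scale E mul'"
  proof (unfold_locales, goal_cases)
    case 1
    show ?case by (fact subE)
  next
    case (2 x y)
    show ?case by (simp add: E_def mul'_def L_apply)
  next
    case (3 x y z)
    show ?case by (simp add: mul'_def fun_eq_iff distrib_right sum.distrib)
  next
    case (4 x y z)
    show ?case by (simp add: mul'_def fun_eq_iff distrib_left distrib_right sum.distrib)
  next
    case (5 x y c)
    show ?case by (simp add: mul'_def fun_scale_def fun_eq_iff sum_distrib_left mult.assoc)
  next
    case (6 x y c)
    show ?case by (simp add: mul'_def fun_scale_def fun_eq_iff sum_distrib_left mult_ac)
  qed
  have sum_e: "(\<Sum>k<m. fun_scale (c k) (e k)) = (\<lambda>i. if i < m then c i else 0)" for c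
  proof
    fix i
    have "(\<Sum>k<m. fun_scale (c k) (e k)) i = (\<Sum>k<m. fun_scale (c k) (e k) i)"
      by (induction m) auto
    also have "\<dots> = (\<Sum>k<m. if k = i then c k else 0)"
      by (intro sum.cong) (auto simp: fun_scale_def e_def)
    finally show "(\<Sum>k<m. fun_scale (c k) (e k)) i = (if i < m then c i else 0)" by simp
  qed
  have inj_e: "inj e" by (rule injI) (metis e_def zero_neq_one)
  have ind: "F.independent (e ` {..<m})"
  proof (rule F.independent_if_scalars_zero)
    fix c x assume "(\<Sum>x\<in>e ` {..<m}. fun_scale (c x) x) = 0" "x \<in> e ` {..<m}"
    then obtain k where k: "k < m" "x = e k" "(\<Sum>k<m. fun_scale (c (e k)) (e k)) = 0"
      using inj_on_subset[OF inj_e] by (auto simp: sum.reindex)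
    show "c x = 0" using fun_cong[OF k(3)[unfolded sum_e], of k] k(1,2) by simp
  qed auto
  have spn: "F.span (e ` {..<m}) = E"
  proof
    show "F.span (e ` {..<m}) \<subseteq> E"
      by (rule F.span_minimal[OF _ subE]) (auto simp: E_def e_def)
    show "E \<subseteq> F.span (e ` {..<m})"
    proof
      fix p assume "p \<in> E"
      then have p: "(\<Sum>k<m. fun_scale (p k) (e k)) = p" unfolding sum_e by (auto simp: E_def)
      have "(\<Sum>k<m. fun_scale (p k) (e k)) \<in> F.span (e ` {..<m})"
        by (intro F.span_sum F.span_scale F.span_base) auto
      then show "p \<in> F.span (e ` {..<m})" by (simp only: p)
    qed
  qed
  have "evolution_algebra fun_scale E mul'"
    unfolding evolution_algebra_def is_basis_def
  proof (intro conjI exI[of _ "e ` {..<m}"] ballI impI)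
    fix x y assume "x \<in> e ` {..<m}" "y \<in> e ` {..<m}" "x \<noteq> y"
    then show "mul' x y = 0" by (auto simp: mul'_def e_def fun_eq_iff intro!: sum.neutral)
  qed (use alg ind spn in auto)
  moreover have "algebra_mono s mul fun_scale E mul' L"
    unfolding algebra_mono_def
  proof (intro conjI allI)
    show "inj L" unfolding L_def using inj_associated_map_iff lv by blast
    show "range L \<subseteq> E" by (auto simp: E_def L_apply)
    fix x y
    have "mul x y = (\<Sum>k<m. s (l k x * l k y) (v k))" using lv(1) by (simp add: diagonal_expansion_def)
    then show "L (mul x y) = mul' (L x) (L y)"
      by (auto simp: fun_eq_iff mul'_def L_apply functional_sum functional_scale lin)
  qed (fact linL)
  ultimately have "edim s mul \<le> edimension fun_scale E"
    unfolding edim_def by (intro Inf_lower) blast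
  also have "edimension fun_scale E = enat m"
  proof -
    have "F.dim E = card (e ` {..<m})"
      using F.dim_eq_card[of "e ` {..<m}" E] ind spn by (metis F.span_span)
    moreover have "\<exists>S. finite S \<and> E \<subseteq> F.span S" using spn by (intro exI[of _ "e ` {..<m}"]) auto
    ultimately show ?thesis
      using inj_on_subset[OF inj_e] by (simp add: edimension_def card_image)
  qed
  finally show ?thesis .
qed

text \<open>Each injective length yields an evolution algebra of that dimension, and conversely for
  finite-dimensional targets. Infinite-dimensional targets contribute \<infinity> and cannot lower
  the infimum.\<close>

lemma edim_eq: "edim s mul = Inf {enat m | m. injective_waring_length m}"
proof (rule antisym)
  show "edim s mul \<le> Inf {enat m | m. injective_waring_length m}"
    by (rule Inf_greatest) (auto intro: edim_le_injective_waring_length)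
  show "Inf {enat m | m. injective_waring_length m} \<le> edim s mul"
    unfolding edim_def
  proof (safe intro!: Inf_greatest)
    fix E mul' f
    assume "evolution_algebra fun_scale E mul'" "algebra_mono s mul fun_scale E mul' f"
    then show "Inf {enat m | m. injective_waring_length m} \<le> edimension fun_scale E"
      by (auto simp: edimension_def intro!: Inf_lower injective_waring_length_dim_evolution_algebra)
  qed
qed

end

section \<open>Characteristic different from two and the chain of equalities\<close>

lemma two_neq_zero_if_CHAR:
  assumes "CHAR('f::field) \<noteq> 2"
  shows "(2 :: 'f) \<noteq> 0"
proof
  assume "(2 :: 'f) = 0"
  then have dvd: "CHAR('f) dvd 2" using of_nat_eq_0_iff_char_dvd[of 2, where 'a = 'f] by simp
  then have "CHAR('f) \<le> 2" "CHAR('f) \<noteq> 0" by (auto dest: dvd_imp_le intro: gr0I)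
  then show False using assms CHAR_not_1[where 'a = 'f] by linarith
qed

theorem mainTheorem8:
  fixes s :: "'f::field \<Rightarrow> 'v::ab_group_add \<Rightarrow> 'v"
    and mul :: "'v \<Rightarrow> 'v \<Rightarrow> 'v"
    and Basis :: "'v set"
  assumes "CHAR('f) \<noteq> 2"
    and "finite_dimensional_vector_space s Basis"
    and "algebra_on s UNIV mul"
    and "\<And>x y. mul x y = mul y x"
  shows "edim s mul \<noteq> \<infinity> \<and>
         edim s mul = enat (vector_space.dim s (UNIV :: 'v set)) + eps s mul \<and>
         enat (vector_space.dim s (UNIV :: 'v set)) + eps s mul = sr s (\<lambda>x. mul x x) \<and>
         sr s (\<lambda>x. mul x x) = wr s (\<lambda>x. mul x x) + enat (vector_space.dim s (Ann mul)) \<and>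
         ((\<exists>u. \<forall>x. mul u x = x \<and> mul x u = x) \<longrightarrow> edim s mul = wr s (\<lambda>x. mul x x))"
proof -
  interpret commutative_algebra s Basis mul
    using assms two_neq_zero_if_CHAR
    by (simp add: commutative_algebra_def commutative_algebra_axioms_def)
  have sr_edim: "sr s (\<lambda>x. mul x x) = edim s mul" by (simp add: sr_eq edim_eq)
  have edim_eps: "edim s mul = enat (dim UNIV) + eps s mul"
    unfolding edim_eq eps_eq
    using enat_Inf_shift[where P = injective_waring_length and Q = off_diagonal_length,
        OF off_diagonal_length_diff_dim injective_waring_length_add_dim]
    by (simp add: add.commute)
  have edim_wr: "edim s mul = wr s (\<lambda>x. mul x x) + enat (dim (Ann mul))"
    unfolding edim_eq wr_eq
    by (rule enat_Inf_shift[where P = injective_waring_length and Q = waring_length,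
          OF waring_length_diff_Ann injective_waring_length_add_Ann])
  \<comment> \<open>Some off-diagonal expansion always exists, and its length bounds
    \<open>edim\<close> by a natural number.\<close>
  obtain t where "off_diagonal_length t" using ex_off_diagonal_length ..
  then have "edim s mul \<le> enat (dim UNIV + t)"
    using edim_le_injective_waring_length injective_waring_length_add_dim by blast
  then have "edim s mul \<noteq> \<infinity>" by (cases "edim s mul") auto
  moreover have "edim s mul = wr s (\<lambda>x. mul x x)" if "\<exists>u. \<forall>x. mul u x = x \<and> mul x u = x"
  proof -
    \<comment> \<open>A unit \<open>u\<close> gives \<open>x = mul x u = 0\<close> for every
      \<open>x\<close> in the annihilator.\<close>
    from that have "Ann mul \<subseteq> {0}" by (auto simp: Ann_def) metis
    then have "dim (Ann mul) = 0" by simp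
    with edim_wr show ?thesis by (simp only: zero_enat_def[symmetric] add_0_right)
  qed
  ultimately show ?thesis using sr_edim edim_eps edim_wr by metis
qed

end
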